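(* Let $\mathcal{R}$ be a (finite) constructor TRS compatible with an instance of $\mathsf{POP}^*_{\mathsf{PS}}$, i.e. $l>_{\mathsf{pop*ps}}r$ for all rules $l\to r$ of $\mathcal{R}$, for some safe mapping and admissible precedence. Then the innermost derivation height of any basic term $f(u_1,\dots,u_k;v_1,\dots,v_l)$ is bounded by a polynomial in the maximal depth of the normal arguments $u_1,\dots,u_k$. The polynomial depends only on $\mathcal{R}$ and the signature $\mathcal{F}$.
   Context: Terms over a finite signature $\mathcal{F}=\mathcal{D}\uplus\mathcal{C}$ (defined symbols, constructors) and variables $\mathcal{V}$; values: terms of variables and constructors; basic terms $f(v_1,\dots,v_n)$, $f\in\mathcal{D}$, $v_i$ values; constructor TRS: only basic left-hand sides. Innermost derivation height of $s$: maximal length of an innermost rewrite sequence (redex arguments in normal form) from $s$. $\mathrm{depth}(x)=1$, $\mathrm{depth}(f(t_1..t_n))=1+\max(\{0\}\cup\{\mathrm{depth}(t_i)\})$. A safe mapping gives each symbol a set of safe argument positions (all positions safe for constructors); write $f(s_1,\dots,s_k;s_{k+1},\dots,s_{k+l})$ with the first $k$ normal. A precedence is a preorder $\succsim$ ($\succ$ strict, $\sim$ equivalence), admissible if $\sim$ only relates two defined symbols or two constructors. $s\approx t$ iff $s=t$ or $s=f(\vec s)$, $t=g(\vec t)$, $f\sim g$ and a permutation $\pi$ with $s_i\approx t_{\pi(i)}$ preserving normal/safe status. $\mathcal{T}(\mathcal{F}_{<f},\mathcal{V})$: terms over variables and symbols $g$ with $f\succ g$. For $s=f(s_1..s_{k+l})$: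 $s>_{\mathsf{sq}}t$ iff $s_i(>_{\mathsf{sq}}\cup\approx)t$ for some $i$ (with $i\le k$ if $f\in\mathcal{D}$), or $f\in\mathcal{D}$, $t=g(t_1..t_p)$, $f\succ g$, $s>_{\mathsf{sq}}t_i$ for all $i$. The order $>_{\mathsf{pop*ps}}$: $s>_{\mathsf{pop*ps}}t$ iff (1) $s_i\ge_{\mathsf{pop*ps}}t$ for some $i\in\{1..k+l\}$; or (2) $f\in\mathcal{D}$, $t=g(t_1..t_m;t_{m+1}..t_{m+n})$, $f\succ g$, $s>_{\mathsf{sq}}t_j$ for $j\le m$, $s>_{\mathsf{pop*ps}}t_j$ for $j>m$, and $t_j\notin\mathcal{T}(\mathcal{F}_{<f},\mathcal{V})$ for at most one safe $j$; or (3) $f\in\mathcal{D}$, $t=g(t_1..t_m;t_{m+1}..t_{m+n})$, $f\sim g$, $\{s_1..s_k\}$ is greater than $\{t_1..t_m\}$ in the strict multiset extension of $>_{\mathsf{pop*ps}}$ (modulo $\approx$: remove a nonempty sub-multiset and add elements each strictly smaller than a removed one), and for all safe $j>m$: $s>_{\mathsf{pop*ps}}t_j$ and $t_j\in\mathcal{T}(\mathcal{F}_{<f},\mathcal{V})$. Here $\ge_{\mathsf{pop*ps}}={>_{\mathsf{pop*ps}}}\cup\approx$. *)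

theory Defs
  imports
    "HOL-Library.Multiset"
    "HOL-Library.Extended_Nat"
    "HOL-Computational_Algebra.Polynomial"
begin

section \<open>Terms and rewriting\<close>

datatype (syms: 'f, vars: 'v) tm = Var 'v | Fun 'f "('f, 'v) tm list"

type_synonym ('f, 'v) rules = "(('f, 'v) tm \<times> ('f, 'v) tm) set"

text \<open>A signature is a pair of disjoint sets of symbols (\<open>D\<close> defined, \<open>C\<close> constructors)
  together with an arity function; \<open>terms ar G\<close> are the terms over the symbols in \<open>G\<close>.\<close>

inductive_set terms :: "('f \<Rightarrow> nat) \<Rightarrow> 'f set \<Rightarrow> ('f, 'v) tm set"
  for ar :: "'f \<Rightarrow> nat" and G :: "'f set" where
  "Var x \<in> terms ar G"
| "\<lbrakk>f \<in> G; length ts = ar f; \<forall>t\<in>set ts. t \<in> terms ar G\<rbrakk> \<Longrightarrow> Fun f ts \<in> terms ar G"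

abbreviation (input) value_terms :: "('f \<Rightarrow> nat) \<Rightarrow> 'f set \<Rightarrow> ('f, 'v) tm set" where
  "value_terms ar C \<equiv> terms ar C"

definition basic_terms :: "('f \<Rightarrow> nat) \<Rightarrow> 'f set \<Rightarrow> 'f set \<Rightarrow> ('f, 'v) tm set" where
  "basic_terms ar D C = {Fun f vs | f vs. f \<in> D \<and> length vs = ar f \<and> set vs \<subseteq> value_terms ar C}"

fun depth :: "('f, 'v) tm \<Rightarrow> nat" where
  "depth (Var x) = 1"
| "depth (Fun f ts) = 1 + Max ({0} \<union> depth ` set ts)"

fun subst :: "('v \<Rightarrow> ('f, 'v) tm) \<Rightarrow> ('f, 'v) tm \<Rightarrow> ('f, 'v) tm" where
  "subst \<sigma> (Var x) = \<sigma> x"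
| "subst \<sigma> (Fun f ts) = Fun f (map (subst \<sigma>) ts)"

definition trs :: "('f \<Rightarrow> nat) \<Rightarrow> 'f set \<Rightarrow> ('f, 'v) rules \<Rightarrow> bool" where
  "trs ar F R \<longleftrightarrow> finite R \<and>
     (\<forall>(l, r)\<in>R. l \<in> terms ar F \<and> r \<in> terms ar F \<and> (\<nexists>x. l = Var x) \<and> vars r \<subseteq> vars l)"

definition constructor_trs ::
  "('f \<Rightarrow> nat) \<Rightarrow> 'f set \<Rightarrow> 'f set \<Rightarrow> ('f, 'v) rules \<Rightarrow> bool" where
  "constructor_trs ar D C R \<longleftrightarrow> trs ar (D \<union> C) R \<and> (\<forall>(l, r)\<in>R. l \<in> basic_terms ar D C)"

inductive rstep :: "('f, 'v) rules \<Rightarrow> ('f, 'v) tm \<Rightarrow> ('f, 'v) tm \<Rightarrow> bool"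
  for R :: "('f, 'v) rules" where
  "(l, r) \<in> R \<Longrightarrow> rstep R (subst \<sigma> l) (subst \<sigma> r)"
| "rstep R s t \<Longrightarrow> rstep R (Fun f (us @ s # vs)) (Fun f (us @ t # vs))"

definition normal_form :: "('f, 'v) rules \<Rightarrow> ('f, 'v) tm \<Rightarrow> bool" where
  "normal_form R s \<longleftrightarrow> (\<nexists>t. rstep R s t)"

inductive innermost_step :: "('f, 'v) rules \<Rightarrow> ('f, 'v) tm \<Rightarrow> ('f, 'v) tm \<Rightarrow> bool"
  for R :: "('f, 'v) rules" where
  "\<lbrakk>(l, r) \<in> R; subst \<sigma> l = Fun f ts; \<forall>t\<in>set ts. normal_form R t\<rbrakk>
     \<Longrightarrow> innermost_step R (subst \<sigma> l) (subst \<sigma> r)"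
| "innermost_step R s t \<Longrightarrow> innermost_step R (Fun f (us @ s # vs)) (Fun f (us @ t # vs))"

text \<open>The value is \<open>\<infinity>\<close> iff the innermost rewrite sequences from \<open>s\<close> have unbounded length;
  otherwise the supremum is a maximum.\<close>

definition innermost_dheight :: "('f, 'v) rules \<Rightarrow> ('f, 'v) tm \<Rightarrow> enat" where
  "innermost_dheight R s = Sup {enat n | n. \<exists>t. (innermost_step R ^^ n) s t}"

section \<open>Safe mappings and precedences\<close>

text \<open>Argument positions are counted from \<open>0\<close>, and the safe positions of a symbol need not
  come after the normal ones: the normal and safe arguments of \<open>Fun f ts\<close>, written
  \<open>f(t\<^sub>1,\<dots>,t\<^sub>k; t\<^sub>k\<^sub>+\<^sub>1,\<dots>,t\<^sub>k\<^sub>+\<^sub>l)\<close> on paper, are selected from \<open>ts\<close> by position.\<close>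

definition safe_mapping ::
  "('f \<Rightarrow> nat) \<Rightarrow> 'f set \<Rightarrow> 'f set \<Rightarrow> ('f \<Rightarrow> nat set) \<Rightarrow> bool" where
  "safe_mapping ar D C safe \<longleftrightarrow>
     (\<forall>f\<in>D \<union> C. safe f \<subseteq> {..<ar f}) \<and> (\<forall>c\<in>C. safe c = {..<ar c})"

definition normal_args :: "('f \<Rightarrow> nat set) \<Rightarrow> 'f \<Rightarrow> 'a list \<Rightarrow> 'a list" where
  "normal_args safe f ts = nths ts (- safe f)"

definition safe_args :: "('f \<Rightarrow> nat set) \<Rightarrow> 'f \<Rightarrow> 'a list \<Rightarrow> 'a list" where
  "safe_args safe f ts = nths ts (safe f)"

text \<open>A precedence \<open>P\<close> contains \<open>(f, g)\<close> iff \<open>f\<close> is greater than or equivalent to \<open>g\<close>.\<close>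

definition prec_gt :: "'f rel \<Rightarrow> 'f \<Rightarrow> 'f \<Rightarrow> bool" where
  "prec_gt P f g \<longleftrightarrow> (f, g) \<in> P \<and> (g, f) \<notin> P"

definition prec_eq :: "'f rel \<Rightarrow> 'f \<Rightarrow> 'f \<Rightarrow> bool" where
  "prec_eq P f g \<longleftrightarrow> (f, g) \<in> P \<and> (g, f) \<in> P"

definition admissible_precedence :: "'f set \<Rightarrow> 'f set \<Rightarrow> 'f rel \<Rightarrow> bool" where
  "admissible_precedence D C P \<longleftrightarrow> preorder_on (D \<union> C) P \<and>
     (\<forall>f g. prec_eq P f g \<longrightarrow> (f \<in> D \<and> g \<in> D) \<or> (f \<in> C \<and> g \<in> C))"

abbreviation terms_below :: "('f \<Rightarrow> nat) \<Rightarrow> 'f rel \<Rightarrow> 'f \<Rightarrow> ('f, 'v) tm set" where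
  "terms_below ar P f \<equiv> terms ar {g. prec_gt P f g}"

section \<open>The order\<close>

inductive tm_equiv :: "('f \<Rightarrow> nat set) \<Rightarrow> 'f rel \<Rightarrow> ('f, 'v) tm \<Rightarrow> ('f, 'v) tm \<Rightarrow> bool"
  for safe :: "'f \<Rightarrow> nat set" and P :: "'f rel" where
  "tm_equiv safe P s s"
| "\<lbrakk>prec_eq P f g; bij_betw \<pi> {..<length ss} {..<length ts};
    \<forall>i<length ss. (i \<in> safe f \<longleftrightarrow> \<pi> i \<in> safe g) \<and> tm_equiv safe P (ss ! i) (ts ! \<pi> i)\<rbrakk>
     \<Longrightarrow> tm_equiv safe P (Fun f ss) (Fun g ts)"

inductive gt_sq ::
  "'f set \<Rightarrow> ('f \<Rightarrow> nat set) \<Rightarrow> 'f rel \<Rightarrow> ('f, 'v) tm \<Rightarrow> ('f, 'v) tm \<Rightarrow> bool"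
  for D :: "'f set" and safe :: "'f \<Rightarrow> nat set" and P :: "'f rel" where
  "\<lbrakk>s \<in> set (if f \<in> D then normal_args safe f ss else ss);
    gt_sq D safe P s t \<or> tm_equiv safe P s t\<rbrakk>
     \<Longrightarrow> gt_sq D safe P (Fun f ss) t"
| "\<lbrakk>f \<in> D; prec_gt P f g; \<forall>t\<in>set ts. gt_sq D safe P (Fun f ss) t\<rbrakk>
     \<Longrightarrow> gt_sq D safe P (Fun f ss) (Fun g ts)"

text \<open>Strict multiset extension of \<open>gt\<close> modulo \<open>eq\<close>: the part \<open>K\<close> of \<open>M\<close> that is kept
  agrees with the part \<open>K'\<close> of \<open>N\<close> up to \<open>eq\<close>.\<close>

definition mset_gt ::
  "('a \<Rightarrow> 'a \<Rightarrow> bool) \<Rightarrow> ('a \<Rightarrow> 'a \<Rightarrow> bool) \<Rightarrow> 'a multiset \<Rightarrow> 'a multiset \<Rightarrow> bool" where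
  "mset_gt eq gt M N \<longleftrightarrow> (\<exists>K K' X Y. M = K + X \<and> N = K' + Y \<and> rel_mset eq K K' \<and>
     X \<noteq> {#} \<and> (\<forall>y\<in>#Y. \<exists>x\<in>#X. gt x y))"

lemma mset_gt_mono [mono]: "gt \<le> gt' \<Longrightarrow> mset_gt eq gt M N \<longrightarrow> mset_gt eq gt' M N"
  unfolding mset_gt_def by (blast dest: predicate2D)

inductive gt_pops ::
  "('f \<Rightarrow> nat) \<Rightarrow> 'f set \<Rightarrow> ('f \<Rightarrow> nat set) \<Rightarrow> 'f rel \<Rightarrow> ('f, 'v) tm \<Rightarrow> ('f, 'v) tm \<Rightarrow> bool"
  for ar :: "'f \<Rightarrow> nat" and D :: "'f set" and safe :: "'f \<Rightarrow> nat set" and P :: "'f rel" where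
  "\<lbrakk>s \<in> set ss; gt_pops ar D safe P s t \<or> tm_equiv safe P s t\<rbrakk>
     \<Longrightarrow> gt_pops ar D safe P (Fun f ss) t"
| "\<lbrakk>f \<in> D; prec_gt P f g;
    \<forall>t\<in>set (normal_args safe g ts). gt_sq D safe P (Fun f ss) t;
    \<forall>t\<in>set (safe_args safe g ts). gt_pops ar D safe P (Fun f ss) t;
    length (filter (\<lambda>t. t \<notin> terms_below ar P f) (safe_args safe g ts)) \<le> 1\<rbrakk>
     \<Longrightarrow> gt_pops ar D safe P (Fun f ss) (Fun g ts)"
| "\<lbrakk>f \<in> D; prec_eq P f g;
    mset_gt (tm_equiv safe P) (gt_pops ar D safe P)
      (mset (normal_args safe f ss)) (mset (normal_args safe g ts));
    \<forall>t\<in>set (safe_args safe g ts). gt_pops ar D safe P (Fun f ss) t \<and> t \<in> terms_below ar P f\<rbrakk>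
     \<Longrightarrow> gt_pops ar D safe P (Fun f ss) (Fun g ts)"

definition pops_compatible ::
  "('f \<Rightarrow> nat) \<Rightarrow> 'f set \<Rightarrow> 'f set \<Rightarrow> ('f \<Rightarrow> nat set) \<Rightarrow> 'f rel \<Rightarrow> ('f, 'v) rules \<Rightarrow> bool" where
  "pops_compatible ar D C safe P R \<longleftrightarrow>
     safe_mapping ar D C safe \<and> admissible_precedence D C P \<and>
     (\<forall>(l, r)\<in>R. gt_pops ar D safe P l r)"

end

theory Submission
  imports Defs
begin

text \<open>Normal forms take the role of values, since a call that is stuck stays a normal form.
  By induction on the precedence, the cost of a call with evaluated arguments is bounded by a
  polynomial in the depth \<open>d\<close> of its normal arguments, independently of its safe arguments.
  The normal arguments of calls to smaller symbols are built from the normal arguments of the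
  redex only. A step increases the depth by at most a constant, so these arguments evaluate to
  normal forms whose depth is polynomial in \<open>d\<close>. The condition on the safe arguments
  leaves at most one recursive call in a right-hand side, and the multiset of the depths of the
  normal arguments decreases strictly along recursive calls. This multiset has at most \<open>k\<close>
  elements, all at most \<open>d\<close>, where \<open>k\<close> bounds the arities, so recursive calls are
  nested at most polynomially often.\<close>

section \<open>Polynomial functions\<close>

text \<open>Bounds are kept as functions, so that they can be defined by recursion and composed. A
  polynomial is extracted only at the end.\<close>

definition poly_fun :: "(nat \<Rightarrow> nat) \<Rightarrow> bool" where
  "poly_fun f \<longleftrightarrow> (\<exists>p. \<forall>x. f x = poly p x)"

lemma poly_fun_const: "poly_fun (\<lambda>_. c)"
  unfolding poly_fun_def by (rule exI[of _ "[:c:]"]) simp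

lemma poly_fun_id: "poly_fun (\<lambda>x. x)"
  unfolding poly_fun_def by (rule exI[of _ "[:0, 1:]"]) simp

lemma poly_fun_add: "poly_fun f \<Longrightarrow> poly_fun g \<Longrightarrow> poly_fun (\<lambda>x. f x + g x)"
  unfolding poly_fun_def by (metis poly_add)

lemma poly_fun_mult: "poly_fun f \<Longrightarrow> poly_fun g \<Longrightarrow> poly_fun (\<lambda>x. f x * g x)"
  unfolding poly_fun_def by (metis poly_mult)

lemma poly_fun_power: "poly_fun f \<Longrightarrow> poly_fun (\<lambda>x. f x ^ n)"
  unfolding poly_fun_def by (metis poly_power)

lemma poly_fun_compose: "poly_fun f \<Longrightarrow> poly_fun g \<Longrightarrow> poly_fun (\<lambda>x. f (g x))"
  unfolding poly_fun_def by (metis poly_pcompose)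

lemma poly_fun_sum: "(\<And>i. i \<in> I \<Longrightarrow> poly_fun (f i)) \<Longrightarrow> poly_fun (\<lambda>x. \<Sum>i\<in>I. f i x)"
  by (induction I rule: infinite_finite_induct) (auto intro: poly_fun_const poly_fun_add)

lemmas poly_fun_intros =
  poly_fun_const poly_fun_id poly_fun_add poly_fun_mult poly_fun_power poly_fun_sum

section \<open>Ranks of bounded multisets\<close>

definition bounded_msets :: "nat \<Rightarrow> nat \<Rightarrow> nat multiset set" where
  "bounded_msets k d = {M. size M \<le> k \<and> set_mset M \<subseteq> {..d}}"

text \<open>This turns descent in the multiset order into descent of a natural number. Only the
  finitely many bounded multisets are counted, so the rank is at most polynomial in
  \<open>d\<close>.\<close>

definition mset_rank :: "nat \<Rightarrow> nat \<Rightarrow> nat multiset \<Rightarrow> nat" where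
  "mset_rank k d M = card {N \<in> bounded_msets k d. (N, M) \<in> mult less_than}"

text \<open>Counting lists instead of multisets overcounts, but for fixed \<open>k\<close> their
  number is still polynomial in \<open>d\<close>.\<close>

lemma bounded_msets_eq:
  "bounded_msets k d = mset ` {xs. set xs \<subseteq> {..d} \<and> length xs \<le> k}"
proof (intro set_eqI iffI)
  fix M assume "M \<in> bounded_msets k d"
  moreover obtain xs where "M = mset xs" by (metis ex_mset)
  ultimately show "M \<in> mset ` {xs. set xs \<subseteq> {..d} \<and> length xs \<le> k}"
    by (auto simp: bounded_msets_def)
qed (auto simp: bounded_msets_def)

lemma finite_bounded_msets: "finite (bounded_msets k d)"
  unfolding bounded_msets_eq by (intro finite_imageI finite_lists_length_le) simp

lemma card_bounded_msets: "card (bounded_msets k d) \<le> (\<Sum>i\<le>k. (d + 1) ^ i)"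
proof -
  have "card (bounded_msets k d) \<le> card {xs. set xs \<subseteq> {..d} \<and> length xs \<le> k}"
    unfolding bounded_msets_eq by (intro card_image_le finite_lists_length_le) simp
  then show ?thesis by (simp add: card_lists_length_le)
qed

lemma mset_rank_le: "mset_rank k d M \<le> (\<Sum>i\<le>k. (d + 1) ^ i)"
proof -
  have "mset_rank k d M \<le> card (bounded_msets k d)"
    unfolding mset_rank_def by (intro card_mono finite_bounded_msets) auto
  then show ?thesis using card_bounded_msets le_trans by blast
qed

text \<open>By transitivity whatever is counted for \<open>N\<close> is counted for
  \<open>M\<close>; moreover \<open>N\<close> itself is counted for \<open>M\<close> but, by
  well-foundedness, not for \<open>N\<close>.\<close>

lemma mset_rank_less:
  assumes "N \<in> bounded_msets k d" and "(N, M) \<in> mult less_than"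
  shows "mset_rank k d N < mset_rank k d M"
  unfolding mset_rank_def
proof (rule psubset_card_mono)
  have "(N, N) \<notin> mult less_than"
    using wf_mult[OF wf_less_than] by simp
  moreover have "trans (mult less_than)" by (auto simp: mult_def)
  ultimately show "{N' \<in> bounded_msets k d. (N', N) \<in> mult less_than}
      \<subset> {N' \<in> bounded_msets k d. (N', M) \<in> mult less_than}"
    using assms by (auto dest: transD)
qed (simp add: finite_bounded_msets)

text \<open>The kept parts agree up to \<open>eq\<close> and hence have the same image under
  \<open>h\<close>, which leaves an ordinary multiset descent. The conditions on \<open>h\<close>
  are restricted to members of \<open>M\<close> because depth behaves well only below
  values.\<close>

lemma mset_gt_imp_mult:
  assumes gt: "mset_gt eq gt M N"
    and eq: "\<And>x y. x \<in># M \<Longrightarrow> eq x y \<Longrightarrow> h x = h y"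
    and less: "\<And>x y. x \<in># M \<Longrightarrow> gt x y \<Longrightarrow> h y < h x"
  shows "(image_mset h N, image_mset h M) \<in> mult less_than"
proof -
  obtain A A' X Y where 1: "M = A + X" "N = A' + Y" "rel_mset eq A A'" "X \<noteq> {#}"
    "\<forall>y\<in>#Y. \<exists>x\<in>#X. gt x y"
    using gt unfolding mset_gt_def by blast
  obtain xs ys where 2: "mset xs = A" "mset ys = A'" "list_all2 eq xs ys"
    using 1(3) unfolding rel_mset_def by blast
  have "map h xs = map h ys"
    using 2 1(1) eq by (auto simp: list_all2_conv_all_nth intro!: nth_equalityI)
  then have "image_mset h A = image_mset h A'"
    using 2 by (metis mset_map)
  moreover have "(image_mset h A' + image_mset h Y, image_mset h A' + image_mset h X) \<in> mult less_than"
    using 1 less by (intro one_step_implies_mult) fastforce+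
  ultimately show ?thesis using 1 by simp
qed

text \<open>This traces each normal argument of a recursive call back to a normal argument of the
  left-hand side.\<close>

lemma mset_gt_member:
  assumes "mset_gt eq gt M N" and "y \<in># N"
  shows "\<exists>x\<in>#M. eq x y \<or> gt x y"
proof -
  obtain A A' X Y where 1: "M = A + X" "N = A' + Y" "rel_mset eq A A'"
    "\<forall>y\<in>#Y. \<exists>x\<in>#X. gt x y"
    using assms(1) unfolding mset_gt_def by blast
  obtain xs ys where 2: "mset xs = A" "mset ys = A'" "list_all2 eq xs ys"
    using 1(3) unfolding rel_mset_def by blast
  have "\<exists>x\<in>set xs. eq x y" if "y \<in> set ys" for y
    using that 2(3) by (metis in_set_conv_nth list_all2_conv_all_nth)
  then show ?thesis using 1 2 assms(2) by fastforce
qed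

section \<open>Depth and innermost rewriting\<close>

lemma depth_arg: "s \<in> set ss \<Longrightarrow> depth s < depth (Fun f ss)"
  by (auto simp: less_Suc_eq_le intro!: Max_ge)

lemma depth_Fun_le:
  assumes "\<And>s. s \<in> set ss \<Longrightarrow> depth s \<le> n"
  shows "depth (Fun f ss) \<le> Suc n"
  using assms by auto

lemma terms_syms: "t \<in> terms ar G \<Longrightarrow> syms t \<subseteq> G"
  by (induction rule: terms.induct) auto

lemma terms_FunD:
  assumes "Fun f ts \<in> terms ar G"
  shows "f \<in> G" "length ts = ar f" "\<And>t. t \<in> set ts \<Longrightarrow> t \<in> terms ar G"
  using assms by (auto elim: terms.cases)

lemma depth_var_subst: "x \<in> vars t \<Longrightarrow> depth (\<sigma> x) \<le> depth (subst \<sigma> t)"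
proof (induction t)
  case (Fun f ts)
  then obtain t where "t \<in> set ts" "depth (\<sigma> x) \<le> depth (subst \<sigma> t)" by auto
  then show ?case using depth_arg[of "subst \<sigma> t" "map (subst \<sigma>) ts" f] by auto
qed simp

lemma depth_subst_le:
  assumes "\<And>x. x \<in> vars t \<Longrightarrow> depth (\<sigma> x) \<le> n"
  shows "depth (subst \<sigma> t) \<le> depth t + n"
  using assms
proof (induction t)
  case (Fun f ts)
  \<comment> \<open>\<open>depth (Fun f ts) - 1\<close> is the maximal depth of the arguments;
    \<open>depth_Fun_le\<close> adds the one back.\<close>
  have "depth u \<le> depth (Fun f ts) - 1 + n" if u: "u \<in> set (map (subst \<sigma>) ts)" for u
  proof -
    obtain t where t: "t \<in> set ts" "u = subst \<sigma> t" using u by auto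
    then have "depth u \<le> depth t + n" using Fun by auto
    then show ?thesis using depth_arg[OF t(1), of f] by linarith
  qed
  then have "depth (Fun f (map (subst \<sigma>) ts)) \<le> Suc (depth (Fun f ts) - 1 + n)"
    by (rule depth_Fun_le)
  then show ?case by simp
qed simp

section \<open>Innermost steps and lengths of derivations\<close>

lemma innermost_step_rstep: "innermost_step R s t \<Longrightarrow> rstep R s t"
  by (induction rule: innermost_step.induct) (blast intro: rstep.intros)+

lemma normal_form_no_step: "normal_form R s \<Longrightarrow> \<not> innermost_step R s t"
  using innermost_step_rstep unfolding normal_form_def by blast

lemma normal_form_arg:
  assumes "normal_form R (Fun f ss)" and "s \<in> set ss"
  shows "normal_form R s"
  using assms rstep.intros(2) unfolding normal_form_def by (metis split_list)

definition cost_le :: "('f, 'v) rules \<Rightarrow> ('f, 'v) tm \<Rightarrow> nat \<Rightarrow> bool" where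
  "cost_le R s n \<longleftrightarrow> (\<forall>m t. (innermost_step R ^^ m) s t \<longrightarrow> m \<le> n)"

lemma cost_le_mono: "cost_le R s m \<Longrightarrow> m \<le> n \<Longrightarrow> cost_le R s n"
  unfolding cost_le_def by (meson le_trans)

lemma cost_le_normal_form: "normal_form R s \<Longrightarrow> cost_le R s n"
  unfolding cost_le_def
  by (metis normal_form_no_step relpowp_E2 zero_le)

lemma cost_le_step:
  assumes "\<And>t. innermost_step R s t \<Longrightarrow> cost_le R t n"
  shows "cost_le R s (Suc n)"
  unfolding cost_le_def
proof (intro allI impI)
  fix m t assume "(innermost_step R ^^ m) s t"
  then show "m \<le> Suc n"
  proof (cases m)
    case (Suc j)
    then obtain u where "innermost_step R s u" "(innermost_step R ^^ j) u t"
      using \<open>(innermost_step R ^^ m) s t\<close> by (blast dest: relpowp_Suc_D2)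
    then show ?thesis using assms Suc unfolding cost_le_def by blast
  qed simp
qed

lemma innermost_dheight_le: "cost_le R s n \<Longrightarrow> innermost_dheight R s \<le> enat n"
  unfolding innermost_dheight_def cost_le_def by (auto intro!: Sup_least)

lemma innermost_step_Fun_cases:
  assumes "innermost_step R (Fun f ts) u"
  obtains (root) "\<forall>t\<in>set ts. normal_form R t"
  | (arg) i t' where "i < length ts" "innermost_step R (ts ! i) t'" "u = Fun f (ts[i := t'])"
  using assms
proof (cases rule: innermost_step.cases)
  case (2 s t us vs)
  show ?thesis by (rule arg[of "length us" t]) (use 2 in simp_all)
qed (use root in auto)

text \<open>Here \<open>k i\<close> counts the steps inside the argument \<open>i\<close> before the first root step and \<open>n\<close> all
  steps from the first root step on.\<close>

lemma innermost_args_first: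
  assumes "(innermost_step R ^^ m) (Fun f ts) u"
  shows "\<exists>k n ts'. length ts' = length ts \<and>
    (\<forall>i<length ts. (innermost_step R ^^ k i) (ts ! i) (ts' ! i)) \<and>
    m = (\<Sum>i<length ts. k i) + n \<and> (innermost_step R ^^ n) (Fun f ts') u \<and>
    (n = 0 \<or> (\<forall>t\<in>set ts'. normal_form R t))"
  using assms
proof (induction m arbitrary: u)
  case 0
  then show ?case by (intro exI[of _ "\<lambda>_. 0"] exI[of _ 0] exI[of _ ts]) auto
next
  case (Suc m)
  then obtain u0 where u0: "(innermost_step R ^^ m) (Fun f ts) u0" "innermost_step R u0 u"
    by auto
  then obtain k n ts' where IH: "length ts' = length ts"
    "\<forall>i<length ts. (innermost_step R ^^ k i) (ts ! i) (ts' ! i)"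
    "m = (\<Sum>i<length ts. k i) + n" "(innermost_step R ^^ n) (Fun f ts') u0"
    "n = 0 \<or> (\<forall>t\<in>set ts'. normal_form R t)"
    using Suc.IH by blast
  have step: "(innermost_step R ^^ Suc n) (Fun f ts') u" using IH(4) u0(2) by auto
  show ?case
  proof (cases "\<forall>t\<in>set ts'. normal_form R t")
    case True
    then show ?thesis using IH step by (intro exI[of _ k] exI[of _ "Suc n"] exI[of _ ts']) auto
  next
    case False
    \<comment> \<open>Some argument is not yet normal, so no root step has occurred. The new step
      lies inside an argument and is charged to its counter.\<close>
    then have "n = 0" using IH by auto
    then have "innermost_step R (Fun f ts') u" using step by auto
    then obtain i t' where i: "i < length ts'" "innermost_step R (ts' ! i) t'" "u = Fun f (ts'[i := t'])"
      using False by (cases rule: innermost_step_Fun_cases) auto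
    have "(\<Sum>j<length ts. (k(i := Suc (k i))) j) = Suc (\<Sum>j<length ts. k j)"
      using i(1) IH(1) by (simp add: sum.remove[of "{..<length ts}" i])
    then show ?thesis
      using IH i \<open>n = 0\<close>
      by (intro exI[of _ "k(i := Suc (k i))"] exI[of _ 0] exI[of _ "ts'[i := t']"])
        (auto simp: nth_list_update)
  qed
qed

text \<open>A derivation splits into the evaluation of the arguments and the rest. The reachability
  premise of \<open>root\<close> serves two purposes: it bounds the depth of evaluated arguments,
  and it shows that an argument with \<open>k i = 0\<close> is unchanged.\<close>

lemma cost_le_Fun:
  assumes args: "\<And>i. i < length ts \<Longrightarrow> cost_le R (ts ! i) (k i)"
    and root: "\<And>ts'. length ts' = length ts \<Longrightarrow>
      (\<And>i. i < length ts \<Longrightarrow> \<exists>j\<le>k i. (innermost_step R ^^ j) (ts ! i) (ts' ! i)) \<Longrightarrow>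
      \<forall>t\<in>set ts'. normal_form R t \<Longrightarrow> cost_le R (Fun f ts') n"
  shows "cost_le R (Fun f ts) ((\<Sum>i<length ts. k i) + n)"
  unfolding cost_le_def
proof (intro allI impI)
  fix m u assume "(innermost_step R ^^ m) (Fun f ts) u"
  from innermost_args_first[OF this] obtain j q ts' where 1: "length ts' = length ts"
    "\<forall>i<length ts. (innermost_step R ^^ j i) (ts ! i) (ts' ! i)"
    "m = (\<Sum>i<length ts. j i) + q" "(innermost_step R ^^ q) (Fun f ts') u"
    "q = 0 \<or> (\<forall>t\<in>set ts'. normal_form R t)"
    by blast
  have le: "j i \<le> k i" if "i < length ts" for i
    using that args 1(2) unfolding cost_le_def by blast
  then have "(\<Sum>i<length ts. j i) \<le> (\<Sum>i<length ts. k i)"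
    by (intro sum_mono) simp
  moreover have "q \<le> n"
    using 1 le root[of ts'] unfolding cost_le_def by blast
  ultimately show "m \<le> (\<Sum>i<length ts. k i) + n" using 1(3) by simp
qed

section \<open>Arguments selected by position\<close>

lemma sum_nth_if:
  fixes w :: nat
  shows "(\<Sum>i<length ts. if i \<in> S \<and> Q (ts ! i) then w else 0)
    = w * length (filter Q (nths ts S))"
proof (induction ts rule: rev_induct)
  case (snoc t ts)
  have "(\<Sum>i<length ts. if i \<in> S \<and> Q ((ts @ [t]) ! i) then w else 0)
    = (\<Sum>i<length ts. if i \<in> S \<and> Q (ts ! i) then w else 0)"
    by (intro sum.cong) (auto simp: nth_append)
  then show ?case using snoc by (simp add: nths_append)
qed simp

lemma nths_cong:
  assumes "length xs = length ys" and "\<And>i. i < length xs \<Longrightarrow> i \<in> S \<Longrightarrow> xs ! i = ys ! i"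
  shows "nths xs S = nths ys S"
  using assms
proof (induction xs ys arbitrary: S rule: list_induct2)
  case (Cons x xs y ys)
  have "nths xs {j. Suc j \<in> S} = nths ys {j. Suc j \<in> S}"
    using Cons.prems[of "Suc _"] by (intro Cons.IH) simp
  then show ?case using Cons.prems[of 0] by (simp add: nths_Cons)
qed simp

lemma normal_args_iff:
  "t \<in> set (normal_args safe f ts) \<longleftrightarrow> (\<exists>i<length ts. i \<notin> safe f \<and> t = ts ! i)"
  by (auto simp: normal_args_def set_nths)

lemma safe_args_iff:
  "t \<in> set (safe_args safe f ts) \<longleftrightarrow> (\<exists>i<length ts. i \<in> safe f \<and> t = ts ! i)"
  by (auto simp: safe_args_def set_nths)

lemma normal_argI: "i < length ts \<Longrightarrow> i \<notin> safe f \<Longrightarrow> ts ! i \<in> set (normal_args safe f ts)"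
  by (auto simp: normal_args_iff)

lemma safe_argI: "i < length ts \<Longrightarrow> i \<in> safe f \<Longrightarrow> ts ! i \<in> set (safe_args safe f ts)"
  by (auto simp: safe_args_iff)

section \<open>The bounds\<close>

text \<open>The parameter \<open>T\<close> bounds the cost of calls to smaller symbols, \<open>k\<close> bounds the arities,
  \<open>L\<close> the depth of right-hand sides, and \<open>d\<close> the depth of the normal arguments.
  The index \<open>i\<close> bounds the depth of the part of the right-hand side that is evaluated.\<close>

fun sq_bound :: "nat \<Rightarrow> nat \<Rightarrow> (nat \<Rightarrow> nat) \<Rightarrow> nat \<Rightarrow> nat \<Rightarrow> nat" where
  "sq_bound k L T 0 d = 0"
| "sq_bound k L T (Suc i) d = k * sq_bound k L T i d + T (L + d + L * sq_bound k L T i d)"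

text \<open>Safe arguments are charged recursively and normal ones by \<open>sq_bound\<close>. Only
  \<open>sq_bound\<close> occurs under \<open>T\<close>, since the cost of a call depends on its
  normal arguments alone.\<close>

fun rhs_bound :: "nat \<Rightarrow> nat \<Rightarrow> (nat \<Rightarrow> nat) \<Rightarrow> nat \<Rightarrow> nat \<Rightarrow> nat" where
  "rhs_bound k L T 0 d = 0"
| "rhs_bound k L T (Suc i) d = k * (rhs_bound k L T i d + sq_bound k L T L d)
     + T (L + d + L * sq_bound k L T L d)"

text \<open>Here \<open>h\<close> strictly exceeds the precedence rank of the called symbol. The
  first factor pays for a root step and for the right-hand side without its recursive call; the
  second strictly exceeds every \<open>mset_rank k d M\<close>.\<close>

fun call_bound :: "nat \<Rightarrow> nat \<Rightarrow> nat \<Rightarrow> nat \<Rightarrow> nat" where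
  "call_bound k L 0 d = 0"
| "call_bound k L (Suc h) d =
     (1 + rhs_bound k L (call_bound k L h) L d) * (1 + (\<Sum>i\<le>k. (d + 1) ^ i))"

text \<open>Only the depth varies while \<open>k\<close>, \<open>L\<close> and \<open>i\<close> are
  fixed, so \<open>T\<close> is composed a constant number of times.\<close>

lemma poly_fun_sq_bound:
  assumes "poly_fun T"
  shows "poly_fun (sq_bound k L T i)"
proof (induction i)
  case 0
  show ?case unfolding sq_bound.simps[abs_def] by (rule poly_fun_const)
next
  case (Suc i)
  show ?case
    unfolding sq_bound.simps[abs_def] by (intro poly_fun_intros poly_fun_compose[OF assms] Suc)
qed

lemma poly_fun_rhs_bound:
  assumes "poly_fun T"
  shows "poly_fun (rhs_bound k L T i)"
proof (induction i)
  case 0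
  show ?case unfolding rhs_bound.simps[abs_def] by (rule poly_fun_const)
next
  case (Suc i)
  show ?case
    unfolding rhs_bound.simps[abs_def]
    by (intro poly_fun_intros poly_fun_compose[OF assms] poly_fun_sq_bound assms Suc)
qed

lemma poly_fun_call_bound: "poly_fun (call_bound k L h)"
proof (induction h)
  case 0
  show ?case unfolding call_bound.simps[abs_def] by (rule poly_fun_const)
next
  case (Suc h)
  show ?case
    unfolding call_bound.simps[abs_def] by (intro poly_fun_intros poly_fun_rhs_bound Suc)
qed

section \<open>Evaluation of compatible constructor systems\<close>

locale pops_system =
  fixes D C :: "'f set" and ar :: "'f \<Rightarrow> nat" and R :: "('f, 'v) rules"
    and safe :: "'f \<Rightarrow> nat set" and P :: "'f rel" and k L :: nat
  assumes disjoint: "D \<inter> C = {}"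
    and constructor_trs: "constructor_trs ar D C R"
    and compatible: "pops_compatible ar D C safe P R"
    and arity_le: "f \<in> D \<union> C \<Longrightarrow> ar f \<le> k"
    and rhs_depth_le: "(l, r) \<in> R \<Longrightarrow> depth r \<le> L"
begin

lemma rule_basic:
  assumes "(l, r) \<in> R"
  obtains f vs where "l = Fun f vs" "f \<in> D" "length vs = ar f" "\<And>v. v \<in> set vs \<Longrightarrow> syms v \<subseteq> C"
    "r \<in> terms ar (D \<union> C)" "gt_pops ar D safe P l r"
proof -
  have "l \<in> basic_terms ar D C" "r \<in> terms ar (D \<union> C)" "gt_pops ar D safe P l r"
    using assms constructor_trs compatible
    by (auto simp: constructor_trs_def trs_def pops_compatible_def)
  then show ?thesis using that terms_syms unfolding basic_terms_def by blast
qed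

lemma rule_vars: "(l, r) \<in> R \<Longrightarrow> vars r \<subseteq> vars l"
  using constructor_trs by (auto simp: constructor_trs_def trs_def)

lemma normal_form_constructor:
  assumes "c \<in> C" and "\<And>t. t \<in> set ts \<Longrightarrow> normal_form R t"
  shows "normal_form R (Fun c ts)"
  unfolding normal_form_def
proof
  assume "\<exists>u. rstep R (Fun c ts) u"
  then obtain u where "rstep R (Fun c ts) u" ..
  then show False
  proof cases
    case (1 l r \<sigma>)
    obtain f vs where "l = Fun f vs" "f \<in> D" using rule_basic[OF 1(3)] by blast
    then show ?thesis using 1(1) assms(1) disjoint by auto
  qed (use assms(2) in \<open>auto simp: normal_form_def\<close>)
qed

lemma normal_form_value: "syms t \<subseteq> C \<Longrightarrow> normal_form R t"
proof (induction t)
  case (Var x)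
  show ?case unfolding normal_form_def
  proof
    assume "\<exists>u. rstep R (Var x) u"
    then obtain u where "rstep R (Var x) u" ..
    then show False
    proof cases
      case (1 l r \<sigma>)
      obtain f vs where "l = Fun f vs" using rule_basic[OF 1(3)] by blast
      then show ?thesis using 1(1) by simp
    qed
  qed
qed (auto intro!: normal_form_constructor)

text \<open>Variables of a right-hand side occur on the left, so their instances are no deeper than
  the redex; the right-hand side itself adds at most \<open>L\<close>.\<close>

lemma innermost_step_depth: "innermost_step R s t \<Longrightarrow> depth t \<le> depth s + L"
proof (induction rule: innermost_step.induct)
  case (1 l r \<sigma> f ts)
  have "depth (subst \<sigma> r) \<le> depth r + depth (subst \<sigma> l)"
    using rule_vars[OF 1(1)] by (intro depth_subst_le depth_var_subst) auto
  then show ?case using rhs_depth_le[OF 1(1)] by simp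
next
  case (2 s t f us vs)
  have "depth t' \<le> depth (Fun f (us @ s # vs)) - 1 + L" if "t' \<in> set (us @ t # vs)" for t'
  proof (cases "t' = t")
    case True
    then show ?thesis using 2 depth_arg[of s "us @ s # vs" f] by simp
  next
    case False
    then show ?thesis using that depth_arg[of t' "us @ s # vs" f] by auto
  qed
  then have "depth (Fun f (us @ t # vs)) \<le> Suc (depth (Fun f (us @ s # vs)) - 1 + L)"
    by (rule depth_Fun_le)
  then show ?case by simp
qed

lemma innermost_steps_depth: "(innermost_step R ^^ m) s t \<Longrightarrow> depth t \<le> depth s + L * m"
proof (induction m arbitrary: t)
  case (Suc m)
  then obtain u where "(innermost_step R ^^ m) s u" "innermost_step R u t" by auto
  then show ?case using Suc.IH[of u] innermost_step_depth[of u t] by simp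
qed simp

section \<open>Instances of values under the orders\<close>

lemma prec_eq_constructor: "prec_eq P f g \<Longrightarrow> f \<in> C \<Longrightarrow> g \<in> C"
  using compatible disjoint
  by (auto simp: pops_compatible_def admissible_precedence_def)

text \<open>Equivalence permutes arguments and exchanges symbols, and depth sees neither.\<close>

lemma tm_equiv_depth: "tm_equiv safe P s t \<Longrightarrow> depth (subst \<sigma> t) = depth (subst \<sigma> s)"
proof (induction rule: tm_equiv.induct)
  case (2 f g \<pi> ss ts)
  have set_eq: "depth ` set (map (subst \<sigma>) us) = (\<lambda>i. depth (subst \<sigma> (us ! i))) ` {..<length us}"
    for us
  proof -
    have "set us = (!) us ` {..<length us}" by (auto simp: set_conv_nth)
    then show ?thesis by (simp add: image_image)
  qed
  have "depth ` set (map (subst \<sigma>) ts) = (\<lambda>i. depth (subst \<sigma> (ts ! i))) ` \<pi> ` {..<length ss}"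
    using 2(2) unfolding set_eq by (simp add: bij_betw_def)
  also have "\<dots> = depth ` set (map (subst \<sigma>) ss)"
    using 2(3) unfolding set_eq by (auto simp: image_image)
  finally show ?case by simp
qed simp

text \<open>By admissibility constructors are exchanged only for constructors, so no redex arises.
  Normal forms must be tracked separately from values because \<open>\<sigma>\<close> may insert
  stuck calls.\<close>

lemma tm_equiv_normal_form:
  "tm_equiv safe P s t \<Longrightarrow> syms s \<subseteq> C \<Longrightarrow> normal_form R (subst \<sigma> s) \<Longrightarrow> normal_form R (subst \<sigma> t)"
proof (induction rule: tm_equiv.induct)
  case (2 f g \<pi> ss ts)
  have "normal_form R (subst \<sigma> t)" if "t \<in> set ts" for t
  proof -
    obtain j where "j < length ts" "t = ts ! j" using \<open>t \<in> set ts\<close> by (auto simp: in_set_conv_nth)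
    moreover from this(1) have "j \<in> \<pi> ` {..<length ss}" using 2(2) by (simp add: bij_betw_def)
    ultimately obtain i where i: "i < length ss" "t = ts ! \<pi> i" by auto
    have "normal_form R (subst \<sigma> (ss ! i))"
      using normal_form_arg[OF 2(5)[unfolded subst.simps]] i(1) by simp
    moreover have "syms (ss ! i) \<subseteq> C"
      using 2(4) i(1) nth_mem by fastforce
    ultimately show ?thesis using 2(3) i by blast
  qed
  then show ?case
    using prec_eq_constructor[OF 2(1)] 2(4) by (auto intro!: normal_form_constructor)
qed

text \<open>A value has no defined root, so only the subterm clause applies.\<close>

lemma gt_pops_value:
  assumes "gt_pops ar D safe P s t" and "syms s \<subseteq> C" and "normal_form R (subst \<sigma> s)"
  shows "normal_form R (subst \<sigma> t) \<and> depth (subst \<sigma> t) < depth (subst \<sigma> s)"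
  using assms
proof (induction rule: gt_pops.induct)
  case (1 s ss t f)
  have "syms s \<subseteq> C" "normal_form R (subst \<sigma> s)"
    using 1 normal_form_arg[OF 1(4)[unfolded subst.simps]] by auto
  moreover have "depth (subst \<sigma> s) < depth (subst \<sigma> (Fun f ss))"
    using 1(1) depth_arg[of "subst \<sigma> s" "map (subst \<sigma>) ss"] by simp
  ultimately show ?case
    using 1(2) tm_equiv_normal_form[of s t] tm_equiv_depth[of s t] by fastforce
qed (use disjoint in auto)

lemma gt_sq_value:
  assumes "gt_sq D safe P s t" and "syms s \<subseteq> C" and "normal_form R (subst \<sigma> s)"
  shows "normal_form R (subst \<sigma> t) \<and> depth (subst \<sigma> t) < depth (subst \<sigma> s)"
  using assms
proof (induction rule: gt_sq.induct)
  case (1 s f ss t)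
  then have s: "s \<in> set ss"
    by (auto simp: normal_args_iff split: if_splits)
  have "syms s \<subseteq> C" "normal_form R (subst \<sigma> s)"
    using s 1 normal_form_arg[OF 1(4)[unfolded subst.simps]] by auto
  moreover have "depth (subst \<sigma> s) < depth (subst \<sigma> (Fun f ss))"
    using s depth_arg[of "subst \<sigma> s" "map (subst \<sigma>) ss"] by simp
  ultimately show ?case
    using 1(2) tm_equiv_normal_form[of s t] tm_equiv_depth[of s t] by fastforce
qed (use disjoint in auto)

text \<open>Induction on the precedence becomes induction on this number.\<close>

definition symbol_rank :: "'f \<Rightarrow> nat" where
  "symbol_rank f = card {g \<in> D \<union> C. prec_gt P f g}"

text \<open>Safe arguments do not enter the bound.\<close>

definition call_cost :: "nat \<Rightarrow> (nat \<Rightarrow> nat) \<Rightarrow> bool" where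
  "call_cost h T \<longleftrightarrow> (\<forall>g ws d. g \<in> D \<longrightarrow> symbol_rank g < h \<longrightarrow> length ws = ar g \<longrightarrow>
     (\<forall>w\<in>set ws. normal_form R w) \<longrightarrow> (\<forall>w\<in>set (normal_args safe g ws). depth w \<le> d) \<longrightarrow>
     cost_le R (Fun g ws) (T d))"

end

text \<open>The redex is \<open>subst \<sigma> (Fun f vs)\<close>; as \<open>Fun f vs\<close> is a left-hand side, the \<open>vs\<close> are values.\<close>

locale pops_redex = pops_system D C ar R safe P k L
  for D C :: "'f set" and ar and R :: "('f, 'v) rules" and safe P k L +
  fixes f :: 'f and vs :: "('f, 'v) tm list" and \<sigma> :: "'v \<Rightarrow> ('f, 'v) tm" and d :: nat
    and T :: "nat \<Rightarrow> nat"
  assumes f: "f \<in> D"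
    and vs_values: "v \<in> set vs \<Longrightarrow> syms v \<subseteq> C"
    and vs_normal: "v \<in> set vs \<Longrightarrow> normal_form R (subst \<sigma> v)"
    and vs_depth: "v \<in> set (normal_args safe f vs) \<Longrightarrow> depth (subst \<sigma> v) \<le> d"
    and below_cost: "\<lbrakk>prec_gt P f g; g \<in> D; length ws = ar g; \<And>w. w \<in> set ws \<Longrightarrow> normal_form R w;
      \<And>w. w \<in> set (normal_args safe g ws) \<Longrightarrow> depth w \<le> e\<rbrakk> \<Longrightarrow> cost_le R (Fun g ws) (T e)"
begin

section \<open>Cost of right-hand sides\<close>

lemma normal_args_vs: "v \<in> set (normal_args safe f vs) \<Longrightarrow> v \<in> set vs"
  by (auto simp: normal_args_iff)

lemma gt_sq_arg:
  assumes "v \<in> set (normal_args safe f vs)" and "gt_sq D safe P v t \<or> tm_equiv safe P v t"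
  shows "normal_form R (subst \<sigma> t)" and "depth (subst \<sigma> t) \<le> d"
proof -
  have v: "v \<in> set vs" using assms(1) normal_args_vs by blast
  note facts = vs_values[OF v] vs_normal[OF v]
  show "normal_form R (subst \<sigma> t)"
    using assms(2) gt_sq_value[OF _ facts] tm_equiv_normal_form[OF _ facts] by blast
  have "depth (subst \<sigma> t) \<le> depth (subst \<sigma> v)"
    using assms(2) gt_sq_value[OF _ facts] tm_equiv_depth[of v t \<sigma>] by fastforce
  then show "depth (subst \<sigma> t) \<le> d" using vs_depth[OF assms(1)] by simp
qed

text \<open>The order \<open>gt_sq\<close> peels off smaller symbols until it reaches pieces of
  normal arguments, whose instances have depth at most \<open>d\<close>. Safe arguments of the redex
  are never reached.\<close>

lemma gt_sq_depth:
  "gt_sq D safe P (Fun f vs) t \<Longrightarrow> depth (subst \<sigma> t) \<le> depth t + d"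
proof (induction t)
  case (Var x)
  from Var show ?case
    by cases (use f gt_sq_arg in \<open>fastforce split: if_splits\<close>)
next
  case (Fun g ts)
  from Fun.prems show ?case
  proof cases
    case (1 v)
    then show ?thesis using gt_sq_arg(2)[of v "Fun g ts"] f by (simp del: depth.simps subst.simps)
  next
    case 2
    have "depth u \<le> depth (Fun g ts) - 1 + d" if u: "u \<in> set (map (subst \<sigma>) ts)" for u
    proof -
      obtain t where t: "t \<in> set ts" "u = subst \<sigma> t" using u by auto
      then show ?thesis using Fun.IH 2 depth_arg[OF t(1), of g] by fastforce
    qed
    then show ?thesis using depth_Fun_le[of "map (subst \<sigma>) ts" _ g] by fastforce
  qed
qed

text \<open>An instantiated normal argument has depth at most \<open>L + d\<close>, and each of its
  at most \<open>a\<close> steps adds at most \<open>L\<close>; this gives the argument of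
  \<open>T\<close>. If \<open>g\<close> is a constructor, nothing remains to be done after the
  evaluation of the arguments.\<close>

lemma cost_below:
  assumes g: "prec_gt P f g" and t: "Fun g ts \<in> terms ar (D \<union> C)" and "depth (Fun g ts) \<le> L"
    and sq: "\<And>i. i < length ts \<Longrightarrow> i \<notin> safe g \<Longrightarrow> gt_sq D safe P (Fun f vs) (ts ! i)"
    and costs: "\<And>i. i < length ts \<Longrightarrow> cost_le R (subst \<sigma> (ts ! i)) (c i)"
    and a: "\<And>i. i < length ts \<Longrightarrow> i \<notin> safe g \<Longrightarrow> c i \<le> a"
  shows "cost_le R (subst \<sigma> (Fun g ts)) ((\<Sum>i<length ts. c i) + T (L + d + L * a))"
proof -
  have "cost_le R (Fun g ws) (T (L + d + L * a))"
    if ws: "length ws = length ts" "\<forall>w\<in>set ws. normal_form R w"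
      and reach: "\<And>i. i < length ts \<Longrightarrow> \<exists>j\<le>c i. (innermost_step R ^^ j) (subst \<sigma> (ts ! i)) (ws ! i)"
    for ws
  proof (cases "g \<in> D")
    case True
    have "depth w \<le> L + d + L * a" if w: "w \<in> set (normal_args safe g ws)" for w
    proof -
      obtain i where i: "i < length ts" "i \<notin> safe g" "w = ws ! i"
        using w ws(1) by (auto simp: normal_args_iff)
      obtain j where j: "j \<le> c i" "(innermost_step R ^^ j) (subst \<sigma> (ts ! i)) (ws ! i)"
        using reach[OF i(1)] by blast
      have "depth w \<le> depth (subst \<sigma> (ts ! i)) + L * j"
        using innermost_steps_depth[OF j(2)] i(3) by simp
      moreover have "depth (subst \<sigma> (ts ! i)) \<le> depth (ts ! i) + d"
        using gt_sq_depth[OF sq[OF i(1,2)]] .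
      moreover have "depth (ts ! i) \<le> L"
        using depth_arg[of "ts ! i" ts g] i(1) assms(3) by simp
      moreover have "L * j \<le> L * a"
        using j(1) a[OF i(1,2)] by simp
      ultimately show ?thesis by linarith
    qed
    then show ?thesis
      using True g ws terms_FunD(2)[OF t] by (intro below_cost) auto
  next
    case False
    then have "g \<in> C" using terms_FunD(1)[OF t] by blast
    then show ?thesis
      using ws by (intro cost_le_normal_form normal_form_constructor) auto
  qed
  then show ?thesis
    using cost_le_Fun[of "map (subst \<sigma>) ts" R c g "T (L + d + L * a)"] costs by simp
qed

text \<open>Either \<open>t\<close> comes from a normal argument, so that its instance is already
  normal, or its root is smaller than \<open>f\<close> and its arguments are covered by the bound
  for \<open>i\<close>.\<close>

lemma gt_sq_cost:
  "\<lbrakk>depth t \<le> i; i \<le> L; t \<in> terms ar (D \<union> C); gt_sq D safe P (Fun f vs) t\<rbrakk>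
    \<Longrightarrow> cost_le R (subst \<sigma> t) (sq_bound k L T i d)"
proof (induction i arbitrary: t)
  case 0
  then show ?case by (cases t) auto
next
  case (Suc i)
  from Suc.prems(4) show ?case
  proof cases
    case (1 v)
    then show ?thesis using gt_sq_arg(1)[of v t] f by (auto intro: cost_le_normal_form)
  next
    case (2 g ts)
    have t: "Fun g ts \<in> terms ar (D \<union> C)" using 2 Suc.prems by simp
    have "cost_le R (subst \<sigma> (ts ! j)) (sq_bound k L T i d)" if "j < length ts" for j
    proof (rule Suc.IH)
      have mem: "ts ! j \<in> set ts" using that by simp
      show "depth (ts ! j) \<le> i" using depth_arg[OF mem, of g] 2 Suc.prems by (simp del: depth.simps)
      show "ts ! j \<in> terms ar (D \<union> C)" using terms_FunD(3)[OF t mem] .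
      show "gt_sq D safe P (Fun f vs) (ts ! j)" using 2 mem by blast
    qed (use Suc.prems in simp)
    then have "cost_le R (subst \<sigma> (Fun g ts))
        ((\<Sum>j<length ts. sq_bound k L T i d) + T (L + d + L * sq_bound k L T i d))"
      using 2 Suc.prems t by (intro cost_below) (auto simp del: depth.simps)
    moreover have "length ts \<le> k"
      using terms_FunD(1,2)[OF t] arity_le by fastforce
    ultimately show ?thesis using 2 by (auto elim!: cost_le_mono)
  qed
qed

text \<open>The cost \<open>w\<close> of a recursive call is paid at most once, since a right-hand side contains at
  most one of them.\<close>

lemma gt_pops_cost:
  assumes rec: "\<And>g us. \<lbrakk>prec_eq P f g; g \<in> D; length us = ar g; \<And>u. u \<in> set us \<Longrightarrow> normal_form R u;
      \<And>u. u \<in> set (normal_args safe g us) \<Longrightarrow> depth u \<le> d;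
      (image_mset depth (mset (normal_args safe g us)),
       image_mset (\<lambda>v. depth (subst \<sigma> v)) (mset (normal_args safe f vs))) \<in> mult less_than\<rbrakk>
    \<Longrightarrow> cost_le R (Fun g us) w"
  shows "\<lbrakk>depth t \<le> i; i \<le> L; t \<in> terms ar (D \<union> C); gt_pops ar D safe P (Fun f vs) t\<rbrakk>
    \<Longrightarrow> cost_le R (subst \<sigma> t) (rhs_bound k L T i d + (if t \<in> terms_below ar P f then 0 else w))"
proof (induction i arbitrary: t)
  case 0
  then show ?case by (cases t) auto
next
  case (Suc i)
  let ?b = "rhs_bound k L T i d" and ?a = "sq_bound k L T L d"
  let ?below = "\<lambda>t. t \<in> terms_below ar P f"
  from Suc.prems(4) show ?case
  proof cases
    case (1 v)
    note facts = vs_values[OF 1(1)] vs_normal[OF 1(1)]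
    have "normal_form R (subst \<sigma> t)"
      using 1(2) gt_pops_value[OF _ facts] tm_equiv_normal_form[OF _ facts] by blast
    then show ?thesis by (rule cost_le_normal_form)
  next
    case (2 g ts)
    have t: "Fun g ts \<in> terms ar (D \<union> C)" using 2 Suc.prems by simp
    \<comment> \<open>A recursive call can occur only in a safe argument: normal arguments are
      related by \<open>gt_sq\<close>, which admits smaller symbols only.\<close>
    define c where "c j = (if j \<in> safe g then ?b + (if ?below (ts ! j) then 0 else w) else ?a)" for j
    have args: "cost_le R (subst \<sigma> (ts ! j)) (c j)" if "j < length ts" for j
    proof -
      have mem: "ts ! j \<in> set ts" using that by simp
      have depth: "depth (ts ! j) \<le> i" using depth_arg[OF mem, of g] 2 Suc.prems by (simp del: depth.simps)
      note t' = terms_FunD(3)[OF t mem]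
      show ?thesis
      proof (cases "j \<in> safe g")
        case True
        then have "gt_pops ar D safe P (Fun f vs) (ts ! j)"
          using 2 safe_argI[of j ts safe g] that by blast
        then have "cost_le R (subst \<sigma> (ts ! j)) (?b + (if ?below (ts ! j) then 0 else w))"
          using Suc.IH[OF depth _ t'] Suc.prems(2) by simp
        then show ?thesis using True by (simp add: c_def)
      next
        case False
        then have "gt_sq D safe P (Fun f vs) (ts ! j)"
          using 2 normal_argI[of j ts safe g] that by blast
        then have "cost_le R (subst \<sigma> (ts ! j)) ?a"
          using gt_sq_cost[OF _ order.refl t'] depth Suc.prems(2) by simp
        then show ?thesis using False by (simp add: c_def)
      qed
    qed
    have "gt_sq D safe P (Fun f vs) (ts ! j)" if "j < length ts" "j \<notin> safe g" for j
      using 2 normal_argI[of j ts safe g] that by blast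
    moreover have "c j \<le> ?a" if "j \<notin> safe g" for j using that by (simp add: c_def)
    ultimately have cost: "cost_le R (subst \<sigma> (Fun g ts)) ((\<Sum>j<length ts. c j) + T (L + d + L * ?a))"
      using 2 Suc.prems t args by (intro cost_below) (auto simp del: depth.simps)
    \<comment> \<open>Every position is granted both budgets. What remains is \<open>w\<close> once
      for each safe argument not below \<open>f\<close>, which matches the \<open>filter\<close>
      count in \<open>gt_pops\<close>.\<close>
    have "(\<Sum>j<length ts. c j)
        \<le> (\<Sum>j<length ts. ?b + ?a + (if j \<in> safe g \<and> \<not> ?below (ts ! j) then w else 0))"
      by (intro sum_mono) (auto simp: c_def)
    also have "\<dots> = length ts * (?b + ?a) + w * length (filter (\<lambda>t. \<not> ?below t) (safe_args safe g ts))"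
      using sum_nth_if[where S = "safe g" and Q = "\<lambda>t. \<not> ?below t" and ts = ts and w = w]
      by (simp add: sum.distrib safe_args_def)
    also have "\<dots> \<le> k * (?b + ?a) + (if ?below t then 0 else w)"
    proof (rule add_mono)
      show "length ts * (?b + ?a) \<le> k * (?b + ?a)"
        using terms_FunD(1,2)[OF t] arity_le by (intro mult_right_mono) fastforce+
      show "w * length (filter (\<lambda>t. \<not> ?below t) (safe_args safe g ts)) \<le> (if ?below t then 0 else w)"
      \<comment> \<open>If \<open>t\<close> is below \<open>f\<close>, so are all its arguments and
        \<open>w\<close> is never paid; otherwise the count is at most one.\<close>
      proof (cases "?below t")
        case True
        then have "\<forall>u\<in>set (safe_args safe g ts). ?below u"
          using 2 terms_FunD(3) by (fastforce simp: safe_args_iff)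
        then have "filter (\<lambda>t. \<not> ?below t) (safe_args safe g ts) = []"
          by (simp add: filter_empty_conv)
        then show ?thesis by simp
      next
        case False
        then show ?thesis using 2 by simp
      qed
    qed
    finally show ?thesis using cost 2 by (auto elim!: cost_le_mono)
  next
    case (3 g ts)
    have t: "Fun g ts \<in> terms ar (D \<union> C)" using 3 Suc.prems by simp
    have g: "g \<in> D" using 3 compatible f disjoint
      by (auto simp: pops_compatible_def admissible_precedence_def)
    \<comment> \<open>The root \<open>g\<close> is equivalent to \<open>f\<close>, so the bound to
      be shown does contain \<open>w\<close>.\<close>
    have not_below: "\<not> ?below t"
      using 3 terms_FunD(1) by (fastforce simp: prec_gt_def prec_eq_def)
    have normal: "normal_form R (subst \<sigma> u) \<and> depth (subst \<sigma> u) \<le> d"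
      if u: "u \<in> set (normal_args safe g ts)" for u
    proof -
      obtain v where v: "v \<in> set (normal_args safe f vs)" "tm_equiv safe P v u \<or> gt_pops ar D safe P v u"
        using mset_gt_member[OF 3(4)] u by auto
      have mem: "v \<in> set vs" using v(1) normal_args_vs by blast
      note facts = vs_values[OF mem] vs_normal[OF mem]
      have "depth (subst \<sigma> u) \<le> depth (subst \<sigma> v)"
        using v(2) gt_pops_value[OF _ facts] tm_equiv_depth[of v u \<sigma>] by fastforce
      moreover have "normal_form R (subst \<sigma> u)"
        using v(2) gt_pops_value[OF _ facts] tm_equiv_normal_form[OF _ facts] by blast
      ultimately show ?thesis using vs_depth[OF v(1)] by simp
    qed
    have decrease: "(image_mset (\<lambda>u. depth (subst \<sigma> u)) (mset (normal_args safe g ts)),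
        image_mset (\<lambda>v. depth (subst \<sigma> v)) (mset (normal_args safe f vs))) \<in> mult less_than"
      using 3(4)
    proof (rule mset_gt_imp_mult)
      fix x y assume x: "x \<in># mset (normal_args safe f vs)"
      then have mem: "x \<in> set vs" using normal_args_vs by simp
      show "depth (subst \<sigma> x) = depth (subst \<sigma> y)" if "tm_equiv safe P x y"
        using tm_equiv_depth[OF that] by simp
      show "depth (subst \<sigma> y) < depth (subst \<sigma> x)" if "gt_pops ar D safe P x y"
        using gt_pops_value[OF that vs_values[OF mem] vs_normal[OF mem]] by simp
    qed
    \<comment> \<open>Normal arguments are already evaluated, and safe ones lie below
      \<open>f\<close> and do not pay \<open>w\<close>. Thus \<open>w\<close> is left for the call
      at the root.\<close>
    define c where "c j = (if j \<in> safe g then ?b else 0)" for j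
    have args: "cost_le R (subst \<sigma> (ts ! j)) (c j)" if "j < length ts" for j
    proof (cases "j \<in> safe g")
      case True
      have mem: "ts ! j \<in> set ts" using that by simp
      have depth: "depth (ts ! j) \<le> i" using depth_arg[OF mem, of g] 3 Suc.prems by (simp del: depth.simps)
      have "gt_pops ar D safe P (Fun f vs) (ts ! j)" "?below (ts ! j)"
        using True 3 safe_argI[of j ts safe g] that by blast+
      then show ?thesis
        using Suc.IH[OF depth _ terms_FunD(3)[OF t mem]] Suc.prems(2) True by (simp add: c_def)
    next
      case False
      then have "normal_form R (subst \<sigma> (ts ! j))"
        using normal[OF normal_argI] that by blast
      then show ?thesis by (rule cost_le_normal_form)
    qed
    have "cost_le R (Fun g us) w"
      if us: "length us = length ts" "\<forall>u\<in>set us. normal_form R u"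
        and reach: "\<And>j. j < length ts \<Longrightarrow> \<exists>m\<le>c j. (innermost_step R ^^ m) (subst \<sigma> (ts ! j)) (us ! j)"
      for us
    proof -
      \<comment> \<open>Cost 0 means that normal arguments are not rewritten, so
        \<open>decrease\<close> carries over to the evaluated call.\<close>
      have "us ! j = subst \<sigma> (ts ! j)" if "j < length ts" "j \<notin> safe g" for j
        using reach[OF that(1)] that by (auto simp: c_def)
      then have "nths us (- safe g) = nths (map (subst \<sigma>) ts) (- safe g)"
        using us(1) by (intro nths_cong) auto
      then have eq: "normal_args safe g us = map (subst \<sigma>) (normal_args safe g ts)"
        by (simp add: normal_args_def nths_map)
      show ?thesis
      proof (rule rec)
        show "(image_mset depth (mset (normal_args safe g us)),
            image_mset (\<lambda>v. depth (subst \<sigma> v)) (mset (normal_args safe f vs))) \<in> mult less_than"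
          using decrease by (simp add: eq image_mset.compositionality comp_def)
      qed (use 3 g us normal eq terms_FunD(2)[OF t] in auto)
    qed
    then have cost: "cost_le R (subst \<sigma> (Fun g ts)) ((\<Sum>j<length ts. c j) + w)"
      using cost_le_Fun[of "map (subst \<sigma>) ts" R c g w] args by simp
    have "(\<Sum>j<length ts. c j) \<le> (\<Sum>j<length ts. ?b)"
      by (intro sum_mono) (simp add: c_def)
    also have "\<dots> \<le> k * ?b"
      using terms_FunD(1,2)[OF t] arity_le by fastforce
    finally have "(\<Sum>j<length ts. c j) + w \<le> rhs_bound k L T (Suc i) d + w"
      by (simp add: algebra_simps)
    then show ?thesis using cost 3 not_below by (auto elim!: cost_le_mono)
  qed
qed

end

section \<open>Induction on the precedence and along recursive calls\<close>

context pops_system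
begin

lemma prec_gt_trans:
  assumes "prec_gt P f g" and "(g, h) \<in> P"
  shows "prec_gt P f h"
proof -
  have "trans P"
    using compatible by (auto simp: pops_compatible_def admissible_precedence_def preorder_on_def)
  then show ?thesis using assms unfolding prec_gt_def by (meson transD)
qed

lemma symbol_rank_less:
  assumes "finite (D \<union> C)" and "prec_gt P f g" and "g \<in> D"
  shows "symbol_rank g < symbol_rank f"
  unfolding symbol_rank_def
proof (rule psubset_card_mono)
  show "{h \<in> D \<union> C. prec_gt P g h} \<subset> {h \<in> D \<union> C. prec_gt P f h}"
    using assms prec_gt_trans[OF assms(2)] by (auto simp: prec_gt_def)
qed (use assms(1) in simp)

lemma symbol_rank_eq:
  assumes "prec_eq P f g"
  shows "symbol_rank g = symbol_rank f"
proof -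
  have "trans P"
    using compatible by (auto simp: pops_compatible_def admissible_precedence_def preorder_on_def)
  then have "prec_gt P f h \<longleftrightarrow> prec_gt P g h" for h
    using assms unfolding prec_gt_def prec_eq_def by (meson transD)
  then show ?thesis by (simp add: symbol_rank_def)
qed

text \<open>One root step leads to a right-hand side of cost at most \<open>rhs_bound\<close> plus
  at most one recursive call. That call has the same symbol rank and depth bound \<open>d\<close>,
  but a multiset of smaller rank.\<close>

lemma call_cost_Suc:
  assumes fin: "finite (D \<union> C)" and below: "call_cost h (call_bound k L h)"
  shows "call_cost (Suc h) (call_bound k L (Suc h))"
proof -
  let ?T = "call_bound k L h"
  let ?M = "\<lambda>g ws. image_mset depth (mset (normal_args safe g ws))"
  \<comment> \<open>Since \<open>m\<close> strictly exceeds the rank, the case \<open>m = 0\<close>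
    is void. The symbol \<open>f\<close> varies because recursion may pass through equivalent
    symbols.\<close>
  have main: "cost_le R (Fun f ws) ((1 + rhs_bound k L ?T L d) * m)"
    if "mset_rank k d (?M f ws) < m" "f \<in> D" "symbol_rank f < Suc h"
      "\<And>w. w \<in> set ws \<Longrightarrow> normal_form R w"
      "\<And>w. w \<in> set (normal_args safe f ws) \<Longrightarrow> depth w \<le> d" for f ws m d
    using that
  proof (induction m arbitrary: f ws)
    case (Suc m)
    have "cost_le R t (rhs_bound k L ?T L d + (1 + rhs_bound k L ?T L d) * m)"
      if step: "innermost_step R (Fun f ws) t" for t
      using step
    proof cases
      case (1 l r \<sigma>)
      obtain vs where l: "l = Fun f vs" "length vs = ar f" "\<And>v. v \<in> set vs \<Longrightarrow> syms v \<subseteq> C"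
        "r \<in> terms ar (D \<union> C)" "gt_pops ar D safe P l r"
        using rule_basic[OF 1(3)] 1(1) by (metis subst.simps(2) tm.inject(2))
      have ws: "ws = map (subst \<sigma>) vs" using 1(1) l(1) by simp
      then have normal_ws: "normal_args safe f ws = map (subst \<sigma>) (normal_args safe f vs)"
        by (simp add: normal_args_def nths_map)
      interpret pops_redex D C ar R safe P k L f vs \<sigma> d ?T
      proof
        show "cost_le R (Fun g us) (?T e)"
          if "prec_gt P f g" "g \<in> D" "length us = ar g" "\<And>u. u \<in> set us \<Longrightarrow> normal_form R u"
            "\<And>u. u \<in> set (normal_args safe g us) \<Longrightarrow> depth u \<le> e" for g us e
          using that below symbol_rank_less[OF fin] Suc.prems(3) unfolding call_cost_def by fastforce
      qed (use Suc.prems l ws normal_ws in auto)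
      have "cost_le R (subst \<sigma> r) (rhs_bound k L ?T L d +
          (if r \<in> terms_below ar P f then 0 else (1 + rhs_bound k L ?T L d) * m))"
      proof (rule gt_pops_cost)
        fix g us
        assume g: "prec_eq P f g" "g \<in> D" "length us = ar g" "\<And>u. u \<in> set us \<Longrightarrow> normal_form R u"
          "\<And>u. u \<in> set (normal_args safe g us) \<Longrightarrow> depth u \<le> d"
          and less: "(?M g us, image_mset (\<lambda>v. depth (subst \<sigma> v)) (mset (normal_args safe f vs)))
            \<in> mult less_than"
        have "length (normal_args safe g us) \<le> k"
        proof -
          have "length (normal_args safe g us) \<le> length us"
            unfolding normal_args_def length_nths by (rule order.trans[OF card_mono[of "{..<length us}"]]) auto
          then show ?thesis using g arity_le by fastforce
        qed
        then have "?M g us \<in> bounded_msets k d"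
          using g(5) by (auto simp: bounded_msets_def)
        moreover have "(?M g us, ?M f ws) \<in> mult less_than"
          using less by (simp add: normal_ws image_mset.compositionality comp_def)
        ultimately have "mset_rank k d (?M g us) < m"
          using mset_rank_less Suc.prems(1) by fastforce
        then show "cost_le R (Fun g us) ((1 + rhs_bound k L ?T L d) * m)"
          using g Suc.prems(3) symbol_rank_eq[OF g(1)] by (intro Suc.IH) auto
      qed (use l rhs_depth_le[OF 1(3)] in auto)
      then show ?thesis using 1(2) by (auto elim!: cost_le_mono)
    next
      case (2 s t' us vs)
      then show ?thesis using Suc.prems(4)[of s] normal_form_no_step by auto
    qed
    then have "cost_le R (Fun f ws) (Suc (rhs_bound k L ?T L d + (1 + rhs_bound k L ?T L d) * m))"
      by (rule cost_le_step)
    then show ?case by simp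
  qed simp
  show ?thesis
    unfolding call_cost_def
  proof (intro allI impI)
    fix f ws d
    assume "f \<in> D" "symbol_rank f < Suc h" "\<forall>w\<in>set ws. normal_form R w"
      "\<forall>w\<in>set (normal_args safe f ws). depth w \<le> d"
    moreover have "mset_rank k d (?M f ws) < 1 + (\<Sum>i\<le>k. (d + 1) ^ i)"
      using mset_rank_le[of k d "?M f ws"] by simp
    ultimately show "cost_le R (Fun f ws) (call_bound k L (Suc h) d)"
      unfolding call_bound.simps by (intro main) auto
  qed
qed

text \<open>At \<open>h = 0\<close> no symbol has a smaller rank, so the claim is vacuous.\<close>

lemma call_cost: "finite (D \<union> C) \<Longrightarrow> call_cost h (call_bound k L h)"
  by (induction h) (simp add: call_cost_def, rule call_cost_Suc)

end

theorem theorem7p5: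
  fixes D C :: "'f set" and ar :: "'f \<Rightarrow> nat" and R :: "('f, 'v) rules"
  assumes "finite D" and "finite C" and "D \<inter> C = {}"
    and "constructor_trs ar D C R"
  shows "\<exists>p :: nat poly. \<forall>safe P. pops_compatible ar D C safe P R \<longrightarrow>
    (\<forall>f ts. Fun f ts \<in> basic_terms ar D C \<longrightarrow>
      innermost_dheight R (Fun f ts)
        \<le> enat (poly p (Max ({0} \<union> depth ` set (normal_args safe f ts)))))"
proof -
  \<comment> \<open>The constants \<open>k\<close>, \<open>L\<close> and \<open>h\<close> come from
    the signature and the rules, before \<open>safe\<close> and \<open>P\<close> are fixed; hence
    one polynomial serves all of them. The inserted 0 covers empty sets.\<close>
  define k where "k = Max (insert 0 (ar ` (D \<union> C)))"
  define L where "L = Max (insert 0 ((\<lambda>(l, r). depth r) ` R))"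
  \<comment> \<open>A rank is at most the number of symbols, so the successor exceeds all
    ranks.\<close>
  define h where "h = Suc (card (D \<union> C))"
  obtain p where p: "call_bound k L h d = poly p d" for d
    using poly_fun_call_bound unfolding poly_fun_def by blast
  have "finite R" using assms(4) by (simp add: constructor_trs_def trs_def)
  have "innermost_dheight R (Fun f ts) \<le> enat (poly p (Max ({0} \<union> depth ` set (normal_args safe f ts))))"
    if compatible: "pops_compatible ar D C safe P R" and basic: "Fun f ts \<in> basic_terms ar D C"
    for safe P f ts
  proof -
    interpret pops_system D C ar R safe P k L
    proof
      show "ar g \<le> k" if "g \<in> D \<union> C" for g
        using that assms unfolding k_def by (intro Max_ge) auto
      show "depth r \<le> L" if "(l, r) \<in> R" for l r
        using that \<open>finite R\<close> unfolding L_def by (intro Max_ge) force+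
    qed (use assms compatible in auto)
    have f: "f \<in> D" "length ts = ar f" and "set ts \<subseteq> terms ar C"
      using basic by (auto simp: basic_terms_def)
    then have ts: "\<forall>t\<in>set ts. normal_form R t"
      using terms_syms normal_form_value by blast
    have "symbol_rank f < h"
      unfolding h_def symbol_rank_def using assms by (auto simp: less_Suc_eq_le intro!: card_mono)
    moreover have "depth t \<le> Max ({0} \<union> depth ` set (normal_args safe f ts))"
      if "t \<in> set (normal_args safe f ts)" for t
      using that by (intro Max_ge) auto
    ultimately have "cost_le R (Fun f ts) (call_bound k L h (Max ({0} \<union> depth ` set (normal_args safe f ts))))"
      using call_cost[of h] assms f ts unfolding call_cost_def by blast
    then show ?thesis using innermost_dheight_le p by metis
  qed
  then show ?thesis by blast
qed

end
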